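(* Let $a_1, a_2, \ldots, a_l$ be a geometric sequence of real numbers. The product of any fixed number of terms depends only on the number of terms and the sum of their subscripts: for every positive integer $k$ and all $i_1,\ldots,i_k, j_1,\ldots,j_k \in \{1,\ldots,l\}$ with $i_1+\cdots+i_k = j_1+\cdots+j_k$, one has $$a_{i_1} a_{i_2}\cdots a_{i_k} = a_{j_1} a_{j_2}\cdots a_{j_k}.$$
   Context: Let $l$ be a positive integer (arbitrarily large) and $X=\{1,\ldots,l\}$. A geometric sequence $a_1,\ldots,a_l$ is given by a one-to-one and onto function $f: X \to Y$, $f(n)=a_n$, where $Y=\{a_1,\ldots,a_l\}$ (so the terms are pairwise distinct), with $a_1, r \in \mathbb{R}$ such that $a_n = a_{n-1}\cdot r$ for all $2 \le n \le l$. *)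

theory Defs
  imports Complex_Main
begin

text \<open>
  A finite real geometric sequence $a_1,\ldots,a_l$ is a bijection from $\{1,\ldots,l\}$ onto its
  set of terms (so the terms are pairwise distinct) with a common ratio $r$. Values of \<open>a\<close> outside
  \<open>{1..l}\<close> are irrelevant. Neither $a_1 = 0$ nor $r = 0$ is excluded beyond what distinctness
  of the terms forces.
\<close>

definition geometric_sequence :: "nat \<Rightarrow> (nat \<Rightarrow> real) \<Rightarrow> bool" where
  "geometric_sequence l a \<longleftrightarrow>
     bij_betw a {1..l} (a ` {1..l}) \<and>
     (\<exists>r::real. \<forall>n\<in>{2..l}. a n = a (n - 1) * r)"

end

theory Submission
  imports Defs
begin

text \<open>
  The closed form \<open>a n = a 1 * r ^ (n - 1)\<close> turns a product of \<open>k\<close> terms into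
  \<open>a 1 ^ k * r ^ s\<close>, where \<open>s\<close> is the sum of the shifted subscripts \<open>i m - 1\<close>, that is, the sum of
  the subscripts minus \<open>k\<close>. Only \<open>k\<close> and the sum of the subscripts remain visible. Exponents are
  natural numbers and no term is divided by another, so the degenerate cases \<open>r = 0\<close> and
  \<open>a 1 = 0\<close> are covered by the same computation.
\<close>

lemma geometric_closed_form:
  fixes a :: "nat \<Rightarrow> 'a::comm_monoid_mult"
  assumes step: "\<forall>n\<in>{2..l}. a n = a (n - 1) * r" and "n \<in> {1..l}"
  shows "a n = a 1 * r ^ (n - 1)"
proof -
  have "1 \<le> n" "n \<le> l"
    using assms(2) by auto
  then show ?thesis
  proof (induction n rule: dec_induct)
    case base
    show ?case by simp
  next
    case (step n)
    have "a (Suc n) = a n * r"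
      using assms(1) step.hyps step.prems by auto
    also have "\<dots> = a 1 * r ^ (n - 1) * r"
      using step by simp
    also have "\<dots> = a 1 * r ^ n"
      using \<open>1 \<le> n\<close> by (cases n) (simp_all add: ac_simps)
    finally show ?case by simp
  qed
qed

text \<open>
  Positivity of the subscripts matters here: it makes the truncated differences \<open>i m - 1\<close> add up
  to the sum of the subscripts minus the number of factors.
\<close>

lemma prod_geometric_terms:
  fixes a :: "nat \<Rightarrow> 'a::comm_monoid_mult" and i :: "'b \<Rightarrow> nat"
  assumes "\<forall>n\<in>{2..l}. a n = a (n - 1) * r" and "\<forall>m\<in>M. i m \<in> {1..l}"
  shows "(\<Prod>m\<in>M. a (i m)) = a 1 ^ card M * r ^ (sum i M - card M)"
proof -
  have "(\<Prod>m\<in>M. a (i m)) = (\<Prod>m\<in>M. a 1 * r ^ (i m - 1))"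
    using assms by (intro prod.cong geometric_closed_form) auto
  also have "\<dots> = a 1 ^ card M * r ^ (\<Sum>m\<in>M. i m - 1)"
    by (simp add: prod.distrib power_sum)
  also have "(\<Sum>m\<in>M. i m - 1) = sum i M - card M"
    using assms(2) by (subst sum_subtractf_nat) auto
  finally show ?thesis .
qed

theorem theorem2p3:
  fixes l k :: nat and a :: "nat \<Rightarrow> real" and i j :: "nat \<Rightarrow> nat"
  assumes "l \<ge> 1"
    and "geometric_sequence l a"
    and "k \<ge> 1"
    and "\<forall>m\<in>{1..k}. i m \<in> {1..l}"
    and "\<forall>m\<in>{1..k}. j m \<in> {1..l}"
    and "(\<Sum>m=1..k. i m) = (\<Sum>m=1..k. j m)"
  shows "(\<Prod>m=1..k. a (i m)) = (\<Prod>m=1..k. a (j m))"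
proof -
  obtain r where "\<forall>n\<in>{2..l}. a n = a (n - 1) * r"
    using assms(2) unfolding geometric_sequence_def by blast
  from prod_geometric_terms[OF this assms(4)] prod_geometric_terms[OF this assms(5)]
  show ?thesis
    using assms(6) by simp
qed

end
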